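(* Let $n\in\mathbf N$ and let $$w_n(t)=\sum_{p=0}^\infty\frac{t^{2p+1}}{(2p+1)!!\,(2p+2n+1)!!},\qquad u_n(t)=\sum_{p=0}^\infty\frac{t^p}{p!\,(p+n)!}.$$ Then $$\left|\frac{d^k}{dt^k}\left(w_n(t)-\frac{\pi}{2}\,u_n(t^2/4)\right)\right|\le C^{1+k}(k!)^{(1+s)/2}(1+t)^{-1-sk},\qquad t\ge0,$$ for every $k\in\mathbf N$ and every $s\in[0,1]$, for some constant $C>0$ which is independent of $s$, $k$ and $t\ge0$.
   Context: $\mathbf N=\{0,1,2,\dots\}$. Semifactorials of odd positive integers: $(2m+1)!!=1\cdot3\cdot5\cdots(2m+1)$.
   Formalization: The estimated function is w_n(t) − (π/2)·2^{-n}·u_n(t²/4), with an added factor 2^{-n}; as printed the claim is false for every n ≥ 1 (the difference is unbounded, already for k = 0), and for n = 0 the two formulas coincide. *)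

theory Defs
  imports "HOL-Analysis.Analysis"
begin

text \<open>\<open>odd_semifact m\<close> is the semifactorial $(2m+1)!! = 1\cdot 3\cdot 5\cdots(2m+1)$:
  its argument is \<open>m\<close>, not \<open>2 * m + 1\<close>.\<close>

definition odd_semifact :: "nat \<Rightarrow> nat" where
  "odd_semifact m = (\<Prod>i\<le>m. 2 * i + 1)"

definition w :: "nat \<Rightarrow> real \<Rightarrow> real" where
  "w n t = (\<Sum>p. t ^ (2 * p + 1) / (real (odd_semifact p) * real (odd_semifact (p + n))))"

definition u :: "nat \<Rightarrow> real \<Rightarrow> real" where
  "u n t = (\<Sum>p. t ^ p / (fact p * fact (p + n)))"

text \<open>The printed source estimates $w_n(t) - \frac{\pi}{2} u_n(t^2/4)$, without the factor
  $2^{-n}$ in front of $u_n$ used in the statement. That function grows exponentially for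
  $n \ge 1$: in terms of the modified Struve and Bessel functions,
  $w_n(t) = \frac{\pi}{2} t^{-n} L_n(t)$ and $u_n(t^2/4) = 2^n t^{-n} I_n(t)$, where
  $L_n - I_n$ has only power growth. So $\pi / 2^{n+1}$ is the only coefficient of
  $u_n(t^2/4)$ for which the difference is even bounded; for $n = 0$ it is the printed one.\<close>

end

theory Submission
  imports Defs
begin

text \<open>Expanding \<open>exp (- x * sin \<theta>)\<close> and integrating termwise, the Wallis integrals
  \<open>\<integral> cos\<^sup>2\<^sup>n \<theta> sin\<^sup>m \<theta> d\<theta>\<close> over \<open>[0, \<pi>/2]\<close> turn the even powers into the series of \<open>u n\<close>
  and the odd ones into that of \<open>w n\<close>, up to the common factor $(2n-1)!!$. So the function to be
  estimated is \<open>-1/(2n-1)!!\<close> times the Laplace-type integral of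
  \<open>cos\<^sup>2\<^sup>n \<theta> * exp (- x * sin \<theta>)\<close>. Each derivative in \<open>x\<close> brings down a factor
  \<open>- sin \<theta>\<close>; with \<open>v = sin \<theta>\<close>, powers of \<open>1 + t\<close> are gained from
  \<open>((1 + t) * v / 2)\<^sup>k \<le> k! * exp ((1 + t) * v / 2)\<close>, raised to the power \<open>s\<close>.\<close>

section \<open>Wallis integrals and their recursions\<close>

text \<open>Half the Beta value B(n + 1/2, (m + 1)/2).\<close>

definition wallis :: "nat \<Rightarrow> nat \<Rightarrow> real" where
  "wallis n m = integral {0..pi/2} (\<lambda>\<theta>. cos \<theta> ^ (2*n) * sin \<theta> ^ m)"

text \<open>The parameter \<open>k\<close> closes the family under differentiation in
  \<open>x\<close>. For \<open>k = 0\<close> it is, up to a constant times x^(-n), the difference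
  I_n(x) - L_n(x) of modified Bessel and Struve functions.\<close>

definition laplace_sin :: "nat \<Rightarrow> nat \<Rightarrow> real \<Rightarrow> real" where
  "laplace_sin n k x =
     integral {0..pi/2} (\<lambda>\<theta>. cos \<theta> ^ (2*n) * (- sin \<theta>) ^ k * exp (- x * sin \<theta>))"

lemma wallis_has_integral:
  "((\<lambda>\<theta>. cos \<theta> ^ (2*n) * sin \<theta> ^ m) has_integral wallis n m) {0..pi/2}"
  unfolding wallis_def
  by (intro integrable_integral integrable_continuous_real continuous_intros)

text \<open>The function \<open>f\<close> vanishes at both endpoints, so its derivative integrates
  to 0; replacing cos^2 by 1 - sin^2 there leaves only the integrands for \<open>m\<close> and
  \<open>m + 2\<close>.\<close>

lemma wallis_Suc_Suc:
  "real (m + 2*n + 2) * wallis n (m + 2) = real (m + 1) * wallis n m"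
proof -
  define f where "f = (\<lambda>\<theta>. cos \<theta> ^ (2*n+1) * sin \<theta> ^ (m+1) :: real)"
  define f' where "f' = (\<lambda>\<theta>. real (m+1) * (cos \<theta> ^ (2*n) * sin \<theta> ^ m)
                   - real (m+2*n+2) * (cos \<theta> ^ (2*n) * sin \<theta> ^ (m+2)) :: real)"
  have d: "(f has_real_derivative f' \<theta>) (at \<theta> within {0..pi/2})" for \<theta>
  proof -
    have "(f has_real_derivative f' \<theta>) (at \<theta>)"
    proof -
      have "(real (2*n+1) * (- sin \<theta> * cos \<theta> ^ (2*n))) * sin \<theta> ^ (m+1)
             + (real (m+1) * (cos \<theta> * sin \<theta> ^ m)) * cos \<theta> ^ (2*n+1)
          = real (m+1) * (cos \<theta> ^ (2*n) * sin \<theta> ^ m) * (cos \<theta>)\<^sup>2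
             - real (2*n+1) * (cos \<theta> ^ (2*n) * sin \<theta> ^ (m+2))"
        by (simp add: algebra_simps power2_eq_square)
      also have "\<dots> = f' \<theta>"
        by (simp add: f'_def cos_squared_eq) (simp add: algebra_simps power2_eq_square)
      finally have eq: "(real (2*n+1) * (- sin \<theta> * cos \<theta> ^ (2*n))) * sin \<theta> ^ (m+1)
             + (real (m+1) * (cos \<theta> * sin \<theta> ^ m)) * cos \<theta> ^ (2*n+1) = f' \<theta>" .
      show ?thesis
        using DERIV_mult[OF DERIV_power[OF DERIV_cos[of \<theta>], of "2*n+1"]
                            DERIV_power[OF DERIV_sin[of \<theta>], of "m+1"]]
        unfolding f_def eq[symmetric] by simp
    qed
    then show ?thesis by (rule has_field_derivative_at_within)
  qed
  have "(f' has_integral f (pi/2) - f 0) {0..pi/2}"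
    by (rule fundamental_theorem_of_calculus)
       (use d in \<open>auto simp: has_real_derivative_iff_has_vector_derivative\<close>)
  moreover have "(f' has_integral real (m+1) * wallis n m - real (m+2*n+2) * wallis n (m+2)) {0..pi/2}"
    unfolding f'_def by (intro has_integral_diff has_integral_mult_right wallis_has_integral)
  ultimately have "f (pi/2) - f 0 = real (m+1) * wallis n m - real (m+2*n+2) * wallis n (m+2)"
    by (rule has_integral_unique)
  then show ?thesis by (simp add: f_def)
qed

text \<open>The factorial cancels \<open>m + 1\<close> from the recursion. What remains is
  4(p+1)(p+n+1) for m = 2p and (2p+3)(2p+2n+3) for m = 2p+1, the term ratios of the two
  series.\<close>

lemma wallis_div_fact_Suc_Suc:
  "wallis n (m + 2) / fact (m + 2) = wallis n m / fact m / (real (m + 2) * real (m + 2*n + 2))"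
proof -
  have "wallis n (m + 2) = real (m + 1) * wallis n m / real (m + 2*n + 2)"
    using wallis_Suc_Suc[of m n] by (simp add: field_simps del: of_nat_add of_nat_mult)
  moreover have "fact (m + 2) = real (m + 2) * real (m + 1) * fact m"
    by (simp add: algebra_simps)
  moreover have "a * b / c / (d * a * e) = b / e / (d * c)" if "a \<noteq> 0" for a b c d e :: real
    using that by (simp add: divide_simps)
  ultimately show ?thesis by (metis of_nat_eq_0_iff add_is_0 one_neq_zero)
qed

text \<open>Writing one factor cos^2 as 1 - sin^2 produces \<open>wallis n 2\<close>, which the
  recursion at \<open>m = 0\<close> eliminates.\<close>

lemma wallis_Suc_0: "real (2*n+2) * wallis (Suc n) 0 = real (2*n+1) * wallis n 0"
proof -
  have "((\<lambda>\<theta>. cos \<theta> ^ (2*n) * sin \<theta> ^ 0 - cos \<theta> ^ (2*n) * sin \<theta> ^ 2)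
          has_integral wallis n 0 - wallis n 2) {0..pi/2}"
    by (intro has_integral_diff wallis_has_integral)
  moreover have "cos \<theta> ^ (2*n) * sin \<theta> ^ 0 - cos \<theta> ^ (2*n) * sin \<theta> ^ 2
      = cos \<theta> ^ (2 * Suc n) * sin \<theta> ^ 0" for \<theta> :: real
  proof -
    have "cos \<theta> ^ (2 * Suc n) = cos \<theta> ^ (2*n) * (cos \<theta>)\<^sup>2"
      by (simp add: power2_eq_square mult_ac)
    then show ?thesis unfolding cos_squared_eq by (simp add: right_diff_distrib)
  qed
  ultimately have "((\<lambda>\<theta>. cos \<theta> ^ (2 * Suc n) * sin \<theta> ^ 0) has_integral wallis n 0 - wallis n 2) {0..pi/2}"
    by (simp only:)
  with wallis_has_integral have "wallis (Suc n) 0 = wallis n 0 - wallis n 2"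
    by (rule has_integral_unique)
  then have "real (2*n+2) * wallis (Suc n) 0 = real (2*n+2) * wallis n 0 - real (2*n+2) * wallis n 2"
    by (simp only: right_diff_distrib)
  also have "real (2*n+2) * wallis n 2 = wallis n 0"
    using wallis_Suc_Suc[of 0 n] by (simp add: numeral_2_eq_2)
  also have "real (2*n+2) * wallis n 0 - wallis n 0 = real (2*n+1) * wallis n 0"
    by (simp add: algebra_simps)
  finally show ?thesis .
qed

section \<open>Odd products and closed forms of the Wallis integrals\<close>

text \<open>This is (2n-1)!!, with the empty product 1 at n = 0; \<open>odd_semifact n\<close> is
  one factor longer.\<close>

definition odd_prod :: "nat \<Rightarrow> real" where
  "odd_prod n = (\<Prod>i<n. 2 * real i + 1)"

lemma odd_prod_0 [simp]: "odd_prod 0 = 1"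
  and odd_prod_Suc: "odd_prod (Suc n) = (2 * real n + 1) * odd_prod n"
  by (simp_all add: odd_prod_def)

lemma odd_prod_ge_1: "odd_prod n \<ge> 1"
  unfolding odd_prod_def by (intro prod_ge_1) auto

lemma odd_semifact_Suc: "odd_semifact (Suc n) = (2 * n + 3) * odd_semifact n"
  by (simp add: odd_semifact_def algebra_simps)

lemma odd_semifact_pos: "odd_semifact n > 0"
  by (simp add: odd_semifact_def prod_pos)

lemma odd_semifact_eq: "real (odd_semifact n) = (2 * real n + 1) * odd_prod n"
  by (simp add: odd_semifact_def odd_prod_def lessThan_Suc_atMost[symmetric] algebra_simps)

lemma wallis_0: "wallis n 0 = pi / 2 * odd_prod n / (2 ^ n * fact n)"
proof (induction n)
  case 0
  then show ?case by (simp add: wallis_def)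
next
  case (Suc n)
  have "wallis (Suc n) 0 = real (2*n+1) * wallis n 0 / real (2*n+2)"
    using wallis_Suc_0[of n] by (simp add: field_simps del: of_nat_add of_nat_mult)
  also have "\<dots> = pi / 2 * odd_prod (Suc n) / (2 ^ Suc n * fact (Suc n))"
    unfolding Suc.IH odd_prod_Suc by (simp add: divide_simps)
  finally show ?case .
qed

lemma wallis_1: "wallis n 1 = 1 / (2 * real n + 1)"
proof -
  define f where "f = (\<lambda>\<theta>. - (cos \<theta> ^ (2*n+1)) / (2 * real n + 1))"
  have "((\<lambda>\<theta>. cos \<theta> ^ (2*n) * sin \<theta> ^ 1) has_integral f (pi/2) - f 0) {0..pi/2}"
  proof (rule fundamental_theorem_of_calculus)
    fix \<theta> :: real
    have "(f has_real_derivative cos \<theta> ^ (2*n) * sin \<theta> ^ 1) (at \<theta> within {0..pi/2})"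
    proof -
      have "((\<lambda>\<theta>. - (cos \<theta> ^ Suc (2*n))) has_real_derivative
              (2 * real n + 1) * (cos \<theta> ^ (2*n) * sin \<theta> ^ 1)) (at \<theta> within {0..pi/2})"
        by (rule derivative_eq_intros refl)+ simp
      from DERIV_cdivide[OF this, of "2 * real n + 1"] show ?thesis
        by (simp add: f_def)
    qed
    then show "(f has_vector_derivative cos \<theta> ^ (2*n) * sin \<theta> ^ 1) (at \<theta> within {0..pi/2})"
      by (simp add: has_real_derivative_iff_has_vector_derivative)
  qed simp
  from has_integral_unique[OF wallis_has_integral this] show ?thesis
    by (simp add: f_def)
qed

text \<open>The even moments give the terms of \<open>u n\<close> at x^2/4. The factor
  \<open>odd_prod n\<close> is the same as for the odd moments and can be divided out of the whole
  series.\<close>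

lemma wallis_even:
  "wallis n (2*p) / fact (2*p) = odd_prod n * (pi / 2 * ((1/4) ^ p / (fact p * fact (p + n)) / 2 ^ n))"
proof (induction p)
  case 0
  then show ?case by (simp add: wallis_0 mult_ac)
next
  case (Suc p)
  have "wallis n (2 * Suc p) / fact (2 * Suc p) = wallis n (2*p) / fact (2*p) / (real (2*p+2) * real (2*p+2*n+2))"
    using wallis_div_fact_Suc_Suc[of n "2*p"] by (simp del: fact_Suc)
  also have "\<dots> = odd_prod n * (pi / 2 * ((1/4) ^ Suc p / (fact (Suc p) * fact (Suc p + n)) / 2 ^ n))"
    unfolding Suc.IH by (simp add: divide_simps) (simp add: algebra_simps)
  finally show ?case .
qed

text \<open>The base value 1/(2n+1) is (2n-1)!!/(2n+1)!!, and each step adds one factor to both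
  semifactorials.\<close>

lemma wallis_odd:
  "wallis n (2*p+1) / fact (2*p+1) = odd_prod n / (real (odd_semifact p) * real (odd_semifact (p + n)))"
proof (induction p)
  case 0
  then show ?case using wallis_1[of n] odd_prod_ge_1[of n]
    by (simp add: odd_semifact_eq[of n] odd_semifact_def[of 0])
next
  case (Suc p)
  have "wallis n (2 * Suc p + 1) / fact (2 * Suc p + 1) = wallis n (2*p+1) / fact (2*p+1) / (real (2*p+3) * real (2*p+2*n+3))"
    using wallis_div_fact_Suc_Suc[of n "2*p+1"] by (simp del: fact_Suc add: numeral_3_eq_3)
  also have "\<dots> = odd_prod n / (real (odd_semifact (Suc p)) * real (odd_semifact (Suc p + n)))"
    unfolding Suc.IH using odd_semifact_pos[of p] odd_semifact_pos[of "p+n"]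
    by (simp add: odd_semifact_Suc algebra_simps)
  finally show ?case .
qed

section \<open>Power series of the Laplace-type integral\<close>

text \<open>The exponential series converges uniformly in the angle, being dominated by |x|^m/m!, so
  it may be integrated term by term.\<close>

lemma laplace_sin_sums: "(\<lambda>m. (- x) ^ m * (wallis n m / fact m)) sums laplace_sin n 0 x"
proof -
  define f where "f = (\<lambda>m \<theta>. (- x) ^ m / fact m * (cos \<theta> ^ (2*n) * sin \<theta> ^ m) :: real)"
  have bound: "norm (f m \<theta>) \<le> \<bar>x\<bar> ^ m / fact m" for m \<theta>
  proof -
    have "\<bar>cos \<theta>\<bar> ^ (2*n) * \<bar>sin \<theta>\<bar> ^ m \<le> 1"
      by (intro mult_le_one power_le_one zero_le_power) auto
    from mult_left_mono[OF this, of "\<bar>x\<bar> ^ m / fact m"] show ?thesis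
      by (simp add: f_def abs_mult power_abs)
  qed
  have "summable (\<lambda>m. \<bar>x\<bar> ^ m / fact m)"
    using summable_exp[of "\<bar>x\<bar>"] by (simp add: field_simps)
  with bound have "uniform_limit {0..pi/2} (\<lambda>N \<theta>. \<Sum>m<N. f m \<theta>) (\<lambda>\<theta>. \<Sum>m. f m \<theta>) sequentially"
    by (rule Weierstrass_m_test)
  moreover have "(\<Sum>m. f m \<theta>) = cos \<theta> ^ (2*n) * (- sin \<theta>) ^ 0 * exp (- x * sin \<theta>)" for \<theta>
  proof -
    have "(\<lambda>m. cos \<theta> ^ (2*n) * ((- x * sin \<theta>) ^ m /\<^sub>R fact m)) sums (cos \<theta> ^ (2*n) * exp (- x * sin \<theta>))"
      by (intro sums_mult exp_converges)
    also have "(\<lambda>m. cos \<theta> ^ (2*n) * ((- x * sin \<theta>) ^ m /\<^sub>R fact m)) = (\<lambda>m. f m \<theta>)"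
      unfolding f_def by (intro ext, subst power_mult_distrib) (simp add: field_simps)
    finally show ?thesis by (simp add: sums_iff)
  qed
  ultimately have lim: "uniform_limit {0..pi/2} (\<lambda>N \<theta>. \<Sum>m<N. f m \<theta>)
      (\<lambda>\<theta>. cos \<theta> ^ (2*n) * (- sin \<theta>) ^ 0 * exp (- x * sin \<theta>)) sequentially" by simp
  have "continuous_on {0..pi/2} (\<lambda>\<theta>. \<Sum>m<N. f m \<theta>)" for N
    unfolding f_def by (intro continuous_intros)
  then obtain I J
    where I: "\<And>N. ((\<lambda>\<theta>. \<Sum>m<N. f m \<theta>) has_integral I N) {0..pi/2}"
      and J: "((\<lambda>\<theta>. cos \<theta> ^ (2*n) * (- sin \<theta>) ^ 0 * exp (- x * sin \<theta>)) has_integral J) {0..pi/2}"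
      and IJ: "I \<longlonglongrightarrow> J"
    by (rule uniform_limit_integral[OF lim _ sequentially_bot]) (rule that; blast)
  have "((\<lambda>\<theta>. \<Sum>m<N. f m \<theta>) has_integral (\<Sum>m<N. (- x) ^ m / fact m * wallis n m)) {0..pi/2}" for N
    unfolding f_def by (intro has_integral_sum has_integral_mult_right wallis_has_integral) auto
  with I have "I = (\<lambda>N. \<Sum>m<N. (- x) ^ m * (wallis n m / fact m))"
    by (auto simp: fun_eq_iff dest: has_integral_unique)
  moreover have "laplace_sin n 0 x = J"
    unfolding laplace_sin_def using J by (rule integral_unique)
  ultimately show ?thesis using IJ by (simp add: sums_def)
qed

lemma wallis_nonneg: "wallis n m \<ge> 0"
  by (rule has_integral_nonneg[OF wallis_has_integral])
     (auto intro!: mult_nonneg_nonneg zero_le_power sin_ge_zero cos_ge_zero)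

text \<open>Even and odd powers are summed separately; the sign of (-x)^m gives the \<open>w\<close>
  part its minus.\<close>

lemma w_minus_u_eq_laplace_sin:
  "w n x - pi / 2 * (u n (x\<^sup>2 / 4) / 2 ^ n) = - laplace_sin n 0 x / odd_prod n"
proof -
  define a where "a = (\<lambda>m. wallis n m / fact m)"
  \<comment> \<open>At \<open>- \<bar>x\<bar>\<close> all terms of the series are nonnegative, so
    convergence there is absolute convergence at \<open>x\<close>, and subseries converge
    too.\<close>
  have "summable (\<lambda>m. (- (- \<bar>x\<bar>)) ^ m * a m)"
    using laplace_sin_sums[of "- \<bar>x\<bar>" n] by (simp add: sums_iff a_def)
  then have abs: "summable (\<lambda>m. \<bar>x\<bar> ^ m * a m)" by simp
  have sub: "summable (\<lambda>p. x ^ g p * a (g p))" if "inj g" for g :: "nat \<Rightarrow> nat"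
  proof (rule summable_norm_cancel)
    have "summable ((\<lambda>m. \<bar>x\<bar> ^ m * a m) \<circ> g)"
      by (rule summable_reindex[OF abs that]) (simp add: a_def wallis_nonneg)
    then show "summable (\<lambda>p. norm (x ^ g p * a (g p)))"
      by (simp add: o_def abs_mult power_abs a_def wallis_nonneg)
  qed
  define c where "c = odd_prod n"
  have c: "c > 0" using odd_prod_ge_1[of n] by (simp add: c_def)
  have s_odd: "summable (\<lambda>p. x ^ (2*p+1) * a (2*p+1))"
    by (rule sub) (simp add: inj_on_def)
  then have odd: "(\<lambda>p. - (x ^ (2*p+1) * a (2*p+1))) sums - (\<Sum>p. x ^ (2*p+1) * a (2*p+1))"
    by (intro sums_minus summable_sums)
  have s_even: "summable (\<lambda>p. x ^ (2*p) * a (2*p))"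
    by (rule sub) (simp add: inj_on_def)
  then have even: "(\<lambda>p. x ^ (2*p) * a (2*p)) sums (\<Sum>p. x ^ (2*p) * a (2*p))"
    by (rule summable_sums)
  have "(\<lambda>m. if even m then x ^ (2 * (m div 2)) * a (2 * (m div 2))
              else - (x ^ (2 * ((m - 1) div 2) + 1) * a (2 * ((m - 1) div 2) + 1)))
        sums (- (\<Sum>p. x ^ (2*p+1) * a (2*p+1)) + (\<Sum>p. x ^ (2*p) * a (2*p)))"
    using sums_if[OF odd even] .
  also have "(\<lambda>m. if even m then x ^ (2 * (m div 2)) * a (2 * (m div 2))
              else - (x ^ (2 * ((m - 1) div 2) + 1) * a (2 * ((m - 1) div 2) + 1)))
           = (\<lambda>m. (- x) ^ m * (wallis n m / fact m))"
    by (auto simp: fun_eq_iff a_def elim!: oddE)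
  finally have "laplace_sin n 0 x = - (\<Sum>p. x ^ (2*p+1) * a (2*p+1)) + (\<Sum>p. x ^ (2*p) * a (2*p))"
    using laplace_sin_sums sums_unique2 by blast
  moreover have "(\<Sum>p. x ^ (2*p+1) * a (2*p+1)) = c * w n x"
  proof -
    have eq: "x ^ (2*p+1) * a (2*p+1)
        = c * (x ^ (2*p+1) / (real (odd_semifact p) * real (odd_semifact (p + n))))" for p
      unfolding a_def c_def wallis_odd by simp
    have "summable (\<lambda>p. x ^ (2*p+1) / (real (odd_semifact p) * real (odd_semifact (p + n))))"
      by (rule summable_mult_D[OF s_odd[unfolded eq]]) (use c in simp)
    then show ?thesis unfolding eq w_def by (rule suminf_mult)
  qed
  moreover have "(\<Sum>p. x ^ (2*p) * a (2*p)) = c * pi / 2 / 2 ^ n * u n (x\<^sup>2 / 4)"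
  proof -
    have eq: "x ^ (2*p) * a (2*p) = (c * pi / 2 / 2 ^ n) * ((x\<^sup>2 / 4) ^ p / (fact p * fact (p + n)))" for p
    proof -
      have "x ^ (2*p) = (x\<^sup>2) ^ p" by (rule power_mult)
      then show ?thesis unfolding a_def c_def wallis_even by (simp add: power_divide mult_ac)
    qed
    have "summable (\<lambda>p. (x\<^sup>2 / 4) ^ p / (fact p * fact (p + n) :: real))"
      by (rule summable_mult_D[OF s_even[unfolded eq]]) (use c in simp)
    then show ?thesis unfolding eq u_def by (rule suminf_mult)
  qed
  ultimately have "laplace_sin n 0 x = - (c * w n x) + c * pi / 2 / 2 ^ n * u n (x\<^sup>2 / 4)"
    by (simp only:)
  then show ?thesis using c by (simp add: c_def[symmetric] field_simps)
qed

section \<open>Differentiation under the integral sign\<close>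

lemma laplace_sin_has_derivative:
  "(laplace_sin n k has_real_derivative laplace_sin n (Suc k) x) (at x)"
proof -
  have "((\<lambda>x. integral (cbox 0 (pi/2)) (\<lambda>\<theta>. cos \<theta> ^ (2*n) * (- sin \<theta>) ^ k * exp (- x * sin \<theta>)))
      has_field_derivative
        integral (cbox 0 (pi/2)) (\<lambda>\<theta>. cos \<theta> ^ (2*n) * (- sin \<theta>) ^ Suc k * exp (- x * sin \<theta>)))
      (at x within UNIV)"
    by (rule leibniz_rule_field_derivative)
       (auto intro!: derivative_eq_intros integrable_continuous_real continuous_intros
             simp: case_prod_unfold)
  then show ?thesis
    unfolding laplace_sin_def cbox_interval by simp
qed

lemma deriv_laplace_sin: "(deriv ^^ k) (\<lambda>x. c * laplace_sin n 0 x) = (\<lambda>x. c * laplace_sin n k x)"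
proof (induction k)
  case (Suc k)
  have "deriv (\<lambda>x. c * laplace_sin n k x) x = c * laplace_sin n (Suc k) x" for x
    by (intro DERIV_imp_deriv DERIV_cmult laplace_sin_has_derivative)
  with Suc show ?case by auto
qed simp

section \<open>Decay estimates\<close>

text \<open>Jordan's inequality: sine is concave on this interval and so lies above its
  chord.\<close>

lemma sin_ge_linear:
  assumes "0 \<le> \<theta>" "\<theta> \<le> pi / 2"
  shows "2 / pi * \<theta> \<le> sin \<theta>"
proof -
  have "convex_on {0..pi/2} (\<lambda>x. - sin x)"
    by (rule f''_ge0_imp_convex[where f' = "\<lambda>x. - cos x" and f'' = sin])
       (auto intro!: derivative_eq_intros sin_ge_zero)
  from convex_onD_Icc'[OF this, of \<theta>] assms show ?thesis by simp
qed

text \<open>The factor 1/2 in \<open>y\<close> is chosen so that paying exp(y) for the power of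
  \<open>1 + t\<close> still leaves the decay exp(-y), up to a factor e.\<close>

lemma power_mult_exp_le:
  fixes s t v :: real
  assumes s: "0 \<le> s" "s \<le> 1" and t: "0 \<le> t" and v: "0 \<le> v" "v \<le> 1"
  shows "v ^ k * exp (- t * v)
           \<le> exp 1 * 2 ^ k * fact k powr s * (1 + t) powr (- s * real k) * exp (- ((1 + t) * v / 2))"
proof (cases "v = 0")
  case True
  with True s t show ?thesis by (cases "k = 0") (auto simp: power_0_left)
next
  case False
  with v have v0: "v > 0" by simp
  define y where "y = (1 + t) * v / 2"
  have y: "y > 0" using v0 t by (simp add: y_def)
  have "y ^ k / fact k \<le> exp y"
  proof -
    \<comment> \<open>A single term of a series with nonnegative terms is at most its sum.\<close>
    have "(\<Sum>m\<in>{k}. y ^ m /\<^sub>R fact m) \<le> (\<Sum>m. y ^ m /\<^sub>R fact m)"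
      using y by (intro sum_le_suminf summable_exp_generic) auto
    then show ?thesis by (simp add: exp_def divide_inverse mult.commute)
  qed
  then have "y ^ k \<le> fact k * exp y" by (simp add: field_simps)
  then have "(y ^ k) powr s \<le> (fact k * exp y) powr s"
    using y s by (intro powr_mono2) auto
  also have "\<dots> = fact k powr s * exp (s * y)"
    by (simp add: powr_mult exp_powr_real mult.commute)
  also have "\<dots> \<le> fact k powr s * exp y"
    using s y by (intro mult_left_mono) (auto simp: mult_left_le_one_le)
  finally have ys: "(y ^ k) powr s \<le> fact k powr s * exp y" .
  have v_eq: "v ^ k = (2 ^ k * (y ^ k)) * (1 + t) powr (- real k)"
    using t by (simp add: y_def powr_minus powr_realpow power_mult_distrib power_divide divide_simps)
  have "v ^ k = (v ^ k) powr 1" using v0 by simp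
  \<comment> \<open>Since \<open>v ^ k\<close> is at most 1, lowering the exponent from 1 to
    \<open>s\<close> can only increase it.\<close>
  also have "\<dots> \<le> (v ^ k) powr s"
    using s v0 v by (intro powr_mono') (auto simp: power_le_one)
  also have "\<dots> = (2 ^ k) powr s * (y ^ k) powr s * (1 + t) powr (- s * real k)"
    unfolding v_eq using y t by (simp add: powr_mult powr_powr mult.commute)
  also have "\<dots> \<le> (2 ^ k) powr 1 * (fact k powr s * exp y) * (1 + t) powr (- s * real k)"
    using s ys by (intro mult_right_mono mult_mono powr_mono) auto
  finally have "v ^ k \<le> 2 ^ k * fact k powr s * exp y * (1 + t) powr (- s * real k)" by simp
  then have "v ^ k * exp (- t * v)
      \<le> 2 ^ k * fact k powr s * exp y * (1 + t) powr (- s * real k) * exp (- t * v)"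
    by (intro mult_right_mono) auto
  also have "\<dots> = 2 ^ k * fact k powr s * (1 + t) powr (- s * real k) * exp (y - t * v)"
    by (simp add: exp_diff exp_minus field_simps)
  \<comment> \<open>Here y - t v = v - y, and \<open>v\<close> is at most 1.\<close>
  also have "\<dots> \<le> 2 ^ k * fact k powr s * (1 + t) powr (- s * real k) * exp (1 - y)"
    using v by (intro mult_left_mono) (auto simp: y_def field_simps)
  also have "exp (1 - y) = exp 1 * exp (- ((1 + t) * v / 2))"
    by (simp add: y_def exp_add[symmetric])
  finally show ?thesis by (simp only: mult_ac)
qed

text \<open>The remaining exponential in the pointwise bound, made linear in the angle by Jordan's
  inequality, has integral at most \<pi>/(1+t). This is the extra power of \<open>1 + t\<close>
  present even for k = 0.\<close>

lemma abs_laplace_sin_le: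
  assumes s: "0 \<le> s" "s \<le> 1" and t: "0 \<le> t"
  shows "\<bar>laplace_sin n k t\<bar>
           \<le> (exp 1 * pi) * 2 ^ k * fact k powr s * (1 + t) powr (- 1 - s * real k)"
proof -
  define K where "K = exp 1 * 2 ^ k * fact k powr s * (1 + t) powr (- s * real k)"
  have K: "K \<ge> 0" by (simp add: K_def)
  \<comment> \<open>The rate is (1+t)/2 times the slope 2/\<pi> of the chord.\<close>
  define b where "b = (1 + t) / pi"
  have b: "b > 0" using t by (simp add: b_def)
  define f where "f = (\<lambda>\<theta>. - exp (- b * \<theta>) / b)"
  have "((\<lambda>\<theta>. exp (- b * \<theta>)) has_integral f (pi/2) - f 0) {0..pi/2}"
  proof (rule fundamental_theorem_of_calculus)
    fix \<theta> :: real
    have "(f has_real_derivative exp (- b * \<theta>)) (at \<theta> within {0..pi/2})"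
      unfolding f_def using b by (auto intro!: derivative_eq_intros)
    then show "(f has_vector_derivative exp (- b * \<theta>)) (at \<theta> within {0..pi/2})"
      by (simp add: has_real_derivative_iff_has_vector_derivative)
  qed simp
  from has_integral_mult_right[OF this, of K]
  have major: "((\<lambda>\<theta>. K * exp (- b * \<theta>)) has_integral K * (f (pi/2) - f 0)) {0..pi/2}" .
  have "norm (laplace_sin n k t) \<le> integral {0..pi/2} (\<lambda>\<theta>. K * exp (- b * \<theta>))"
    unfolding laplace_sin_def
  proof (rule integral_norm_bound_integral)
    show "(\<lambda>\<theta>. cos \<theta> ^ (2*n) * (- sin \<theta>) ^ k * exp (- t * sin \<theta>)) integrable_on {0..pi/2}"
      by (intro integrable_continuous_real continuous_intros)
    show "(\<lambda>\<theta>. K * exp (- b * \<theta>)) integrable_on {0..pi/2}"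
      using major by blast
    fix \<theta> assume \<theta>: "\<theta> \<in> {0..pi/2}"
    then have sin0: "sin \<theta> \<ge> 0" by (intro sin_ge_zero) auto
    have "norm (cos \<theta> ^ (2*n) * (- sin \<theta>) ^ k * exp (- t * sin \<theta>))
        = \<bar>cos \<theta>\<bar> ^ (2*n) * (sin \<theta> ^ k * exp (- t * sin \<theta>))"
      using sin0 by (simp add: abs_mult power_abs)
    also have "\<dots> \<le> 1 * (sin \<theta> ^ k * exp (- t * sin \<theta>))"
      using sin0 by (intro mult_right_mono power_le_one) auto
    also have "\<dots> \<le> K * exp (- ((1 + t) * sin \<theta> / 2))"
      unfolding K_def using power_mult_exp_le[OF s t sin0, of k] by simp
    also have "\<dots> \<le> K * exp (- b * \<theta>)"
    proof (intro mult_left_mono K)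
      have "b * \<theta> = (1 + t) / 2 * (2 / pi * \<theta>)" by (simp add: b_def)
      also have "\<dots> \<le> (1 + t) / 2 * sin \<theta>"
        using \<theta> t by (intro mult_left_mono sin_ge_linear) auto
      finally show "exp (- ((1 + t) * sin \<theta> / 2)) \<le> exp (- b * \<theta>)" by simp
    qed
    finally show "norm (cos \<theta> ^ (2*n) * (- sin \<theta>) ^ k * exp (- t * sin \<theta>)) \<le> K * exp (- b * \<theta>)" .
  qed
  also have "\<dots> = K * (f (pi/2) - f 0)"
    using major by (rule integral_unique)
  \<comment> \<open>The integral equals (1 - exp(-b \<pi>/2))/b, which is below 1/b.\<close>
  also have "\<dots> \<le> K * (pi / (1 + t))"
    using b t by (intro mult_left_mono K) (simp add: f_def b_def)
  also have "\<dots> = (exp 1 * pi) * 2 ^ k * fact k powr s * (1 + t) powr (- 1 - s * real k)"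
    using t by (simp add: K_def powr_diff powr_minus field_simps)
  finally show ?thesis by simp
qed

theorem theorem4p2:
  fixes n :: nat
  shows "\<exists>C::real. C > 0 \<and>
    (\<forall>(k::nat) (s::real) (t::real). 0 \<le> s \<longrightarrow> s \<le> 1 \<longrightarrow> 0 \<le> t \<longrightarrow>
      \<bar>(deriv ^^ k) (\<lambda>x. w n x - pi / 2 * (u n (x\<^sup>2 / 4) / 2 ^ n)) t\<bar>
        \<le> C ^ (1 + k) * fact k powr ((1 + s) / 2) * (1 + t) powr (- 1 - s * real k))"
proof -
  define C where "C = exp 1 * pi"
  \<comment> \<open>This lets C^k absorb 2^k, while one further factor \<open>C\<close> is the
    prefactor of the integral bound.\<close>
  have C: "C \<ge> 2"
    using mult_mono[of 1 "exp 1" 2 pi] pi_gt3 by (simp add: C_def)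
  define c where "c = - 1 / odd_prod n"
  have c: "\<bar>c\<bar> \<le> 1" using odd_prod_ge_1[of n] by (simp add: c_def)
  have fun_eq: "(\<lambda>x. w n x - pi / 2 * (u n (x\<^sup>2 / 4) / 2 ^ n)) = (\<lambda>x. c * laplace_sin n 0 x)"
    unfolding w_minus_u_eq_laplace_sin c_def by simp
  have "\<bar>(deriv ^^ k) (\<lambda>x. w n x - pi / 2 * (u n (x\<^sup>2 / 4) / 2 ^ n)) t\<bar>
        \<le> C ^ (1 + k) * fact k powr ((1 + s) / 2) * (1 + t) powr (- 1 - s * real k)"
    if s: "0 \<le> s" "s \<le> 1" and t: "0 \<le> t" for k s t
  proof -
    have "\<bar>(deriv ^^ k) (\<lambda>x. w n x - pi / 2 * (u n (x\<^sup>2 / 4) / 2 ^ n)) t\<bar> = \<bar>c\<bar> * \<bar>laplace_sin n k t\<bar>"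
      unfolding fun_eq deriv_laplace_sin by (simp add: abs_mult)
    also have "\<dots> \<le> 1 * \<bar>laplace_sin n k t\<bar>"
      using c by (intro mult_right_mono) auto
    also have "\<dots> \<le> C * 2 ^ k * fact k powr s * (1 + t) powr (- 1 - s * real k)"
      using abs_laplace_sin_le[OF s t] by (simp add: C_def)
    \<comment> \<open>From s \<le> 1 follows s \<le> (1+s)/2, and k! \<ge> 1, so the exponent of k!
      may be raised.\<close>
    also have "\<dots> \<le> C * C ^ k * fact k powr ((1 + s) / 2) * (1 + t) powr (- 1 - s * real k)"
      using C s by (intro mult_right_mono mult_mono power_mono powr_mono) (auto simp: fact_ge_1)
    finally show ?thesis by simp
  qed
  with C show ?thesis by (intro exI[of _ C]) auto
qed

end
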